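(* Let $n,s$ be positive integers such that $n\ge 3s+3$. Let $H$ be a $3$-graph with vertex set $[n]$. If for every $v\in V(H)$, \[ \rho(N_H(v))>\frac{1}{2}\Big(s-1+\sqrt{(s-1)^2+4s(n-s-1)}\Big), \] then $H$ has a fractional matching of size $s+1$. Moreover, if $n=3s+3$ and $\rho(N_H(v))>2n/3-2$ for every $v\in V(H)$, then $H$ has a perfect fractional matching.
   Context: $[n]=\{1,\dots,n\}$. A $3$-graph $H$ is a $3$-uniform hypergraph: a vertex set $V(H)$ together with an edge set $E(H)\subseteq\binom{V(H)}{3}$, the family of $3$-element subsets of $V(H)$. For $v\in V(H)$, the link graph $N_H(v)$ is the simple graph with vertex set $V(H)\setminus\{v\}$ and edge set $\{e\subseteq V(H)\setminus\{v\}: e\cup\{v\}\in E(H)\}$ (its edges are $2$-sets). For a simple graph $G$, $\rho(G)$ denotes its spectral radius, i.e. the largest eigenvalue of its adjacency matrix. A fractional matching in $H$ is a function $f:E(H)\to[0,1]$ such that $\sum_{e\ni v}f(e)\le 1$ for every $v\in V(H)$; its size is $\sum_{e\in E(H)}f(e)$. It is a perfect fractional matching if $\sum_{e\ni v}f(e)=1$ for every $v\in V(H)$. *)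

theory Defs
  imports "HOL-Library.Ramsey" "Jordan_Normal_Form.Char_Poly"
begin

text \<open>A hypergraph is given by a vertex set and a set of edges;
  \<open>nsets V 3\<close> is the family of all 3-element subsets of \<open>V\<close>.\<close>

definition three_graph :: "'a set \<Rightarrow> 'a set set \<Rightarrow> bool" where
  "three_graph V E \<longleftrightarrow> finite V \<and> E \<subseteq> nsets V 3"

definition link_graph :: "'a set \<Rightarrow> 'a set set \<Rightarrow> 'a \<Rightarrow> 'a set \<times> 'a set set" where
  "link_graph V E v = (V - {v}, {e. e \<subseteq> V - {v} \<and> e \<union> {v} \<in> E})"

text \<open>Matrices are indexed by \<open>{0..<card W}\<close>, so the vertices are listed in increasing order.
  The graph is meant to be simple, i.e. all edges have two elements; the diagonal is then zero.\<close>

definition adjacency_matrix :: "'a::linorder set \<times> 'a set set \<Rightarrow> real mat" where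
  "adjacency_matrix G = (case G of (W, F) \<Rightarrow>
     mat (card W) (card W) (\<lambda>(i, j).
       if {sorted_list_of_set W ! i, sorted_list_of_set W ! j} \<in> F then 1 else 0))"

text \<open>The matrix is real symmetric, so for a nonempty finite vertex set its set of real eigenvalues
  is finite and nonempty and the maximum is meaningful.\<close>

definition graph_spectral_radius :: "'a::linorder set \<times> 'a set set \<Rightarrow> real" where
  "graph_spectral_radius G = Max {k. eigenvalue (adjacency_matrix G) k}"

definition fractional_matching :: "'a set \<Rightarrow> 'a set set \<Rightarrow> ('a set \<Rightarrow> real) \<Rightarrow> bool" where
  "fractional_matching V E f \<longleftrightarrow>
     (\<forall>e\<in>E. 0 \<le> f e \<and> f e \<le> 1) \<and> (\<forall>v\<in>V. (\<Sum>e\<in>{e\<in>E. v \<in> e}. f e) \<le> 1)"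

definition matching_size :: "'a set set \<Rightarrow> ('a set \<Rightarrow> real) \<Rightarrow> real" where
  "matching_size E f = (\<Sum>e\<in>E. f e)"

definition perfect_fractional_matching :: "'a set \<Rightarrow> 'a set set \<Rightarrow> ('a set \<Rightarrow> real) \<Rightarrow> bool" where
  "perfect_fractional_matching V E f \<longleftrightarrow>
     fractional_matching V E f \<and> (\<forall>v\<in>V. (\<Sum>e\<in>{e\<in>E. v \<in> e}. f e) = 1)"

end

theory Submission
  imports Defs "HOL-Analysis.Function_Topology" "Jordan_Normal_Form.Spectral_Radius"
begin

text \<open>If there is no fractional matching of size \<open>s + 1\<close>, then by duality there is a fractional
  vertex cover of total weight less than \<open>s + 1\<close>. Shifting by the smallest weight and rescaling,
  it yields a fractional cover of weight less than \<open>s + 1\<close> of the link graph at a vertex of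
  smallest weight. In a graph with such a cover, deleting the \<open>a\<close> heaviest vertices, for a
  suitable \<open>a \<le> s\<close>, leaves maximum degree at most \<open>2 * (s - a)\<close>, and a positive vector taking only
  two values then shows that the spectral radius is at most the given bound.\<close>

section \<open>Eigenvalue bounds for nonnegative symmetric matrices\<close>

lemma eigenvalue_iff_sum:
  fixes A :: "'a::field mat"
  assumes A: "A \<in> carrier_mat n n"
  shows "eigenvalue A k \<longleftrightarrow>
    (\<exists>y. (\<exists>i<n. y i \<noteq> 0) \<and> (\<forall>i<n. (\<Sum>j<n. A $$ (i, j) * y j) = k * y i))"
proof
  assume "eigenvalue A k"
  then obtain v where v: "v \<in> carrier_vec n" "v \<noteq> 0\<^sub>v n" "A *\<^sub>v v = k \<cdot>\<^sub>v v"
    using A by (auto simp: eigenvalue_def eigenvector_def)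
  have "\<exists>i<n. v $ i \<noteq> 0"
    using v(1,2) by (metis eq_vecI carrier_vecD index_zero_vec(1) zero_carrier_vec)
  moreover have "(\<Sum>j<n. A $$ (i, j) * v $ j) = k * v $ i" if "i < n" for i
  proof -
    have "(\<Sum>j<n. A $$ (i, j) * v $ j) = (A *\<^sub>v v) $ i"
      using A v(1) that by (simp add: scalar_prod_def lessThan_atLeast0)
    then show ?thesis
      using v that by simp
  qed
  ultimately show "\<exists>y. (\<exists>i<n. y i \<noteq> 0) \<and> (\<forall>i<n. (\<Sum>j<n. A $$ (i, j) * y j) = k * y i)"
    by (intro exI[of _ "\<lambda>i. v $ i"]) simp
next
  assume "\<exists>y. (\<exists>i<n. y i \<noteq> 0) \<and> (\<forall>i<n. (\<Sum>j<n. A $$ (i, j) * y j) = k * y i)"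
  then obtain y where y: "\<exists>i<n. y i \<noteq> 0" "\<And>i. i < n \<Longrightarrow> (\<Sum>j<n. A $$ (i, j) * y j) = k * y i"
    by blast
  have "A *\<^sub>v vec n y = k \<cdot>\<^sub>v vec n y"
  proof (rule eq_vecI)
    fix i assume "i < dim_vec (k \<cdot>\<^sub>v vec n y)"
    then show "(A *\<^sub>v vec n y) $ i = (k \<cdot>\<^sub>v vec n y) $ i"
      using A y(2)[of i] by (simp add: scalar_prod_def lessThan_atLeast0)
  qed (use A in simp)
  moreover have "vec n y \<noteq> 0\<^sub>v n"
    using y(1) by (metis index_vec index_zero_vec(1))
  ultimately show "eigenvalue A k"
    using A by (auto simp: eigenvalue_def eigenvector_def intro!: exI[of _ "vec n y"])
qed

text \<open>Guarantees that the \<open>Max\<close> in \<open>graph_spectral_radius\<close> ranges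
  over a nonempty set. A complex eigenvalue always exists, and symmetry forces it to be
  real.\<close>

lemma symmetric_real_mat_eigenvalue_exists:
  fixes A :: "real mat"
  assumes A: "A \<in> carrier_mat n n" and "n > 0"
    and sym: "\<And>i j. i < n \<Longrightarrow> j < n \<Longrightarrow> A $$ (i, j) = A $$ (j, i)"
  shows "\<exists>k. eigenvalue A k"
proof -
  define B where "B = map_mat complex_of_real A"
  have B: "B \<in> carrier_mat n n"
    using A by (simp add: B_def)
  obtain k where k: "eigenvalue B k"
    using spectrum_non_empty[OF B \<open>n > 0\<close>] by (auto simp: spectrum_def)
  then obtain y where y0: "\<exists>i<n. y i \<noteq> 0"
    and y: "\<And>i. i < n \<Longrightarrow> (\<Sum>j<n. B $$ (i, j) * y j) = k * y i"
    unfolding eigenvalue_iff_sum[OF B] by blast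
  have Bij: "B $$ (i, j) = complex_of_real (A $$ (i, j))" if "i < n" "j < n" for i j
    using A that by (simp add: B_def)
  \<comment> \<open>\<open>S\<close> is the Hermitian form of \<open>B\<close> at \<open>y\<close>.
    It equals \<open>k\<close> times the positive number \<open>N\<close>, and conjugation merely
    swaps its two summation indices, so \<open>k\<close> is real.\<close>
  define S where "S = (\<Sum>i<n. \<Sum>j<n. cnj (y i) * (B $$ (i, j) * y j))"
  define N where "N = (\<Sum>i<n. (cmod (y i))\<^sup>2)"
  have "S = (\<Sum>i<n. cnj (y i) * (k * y i))"
    unfolding S_def by (intro sum.cong refl) (simp add: sum_distrib_left[symmetric] y)
  also have "\<dots> = k * complex_of_real N"
    by (simp add: N_def sum_distrib_left complex_norm_square mult_ac del: of_real_power)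
  finally have S: "S = k * complex_of_real N" .
  have "cnj S = (\<Sum>i<n. \<Sum>j<n. cnj (y j) * (B $$ (j, i) * y i))"
    unfolding S_def cnj_sum
    by (intro sum.cong refl) (simp add: Bij sym mult_ac)
  also have "\<dots> = S"
    unfolding S_def by (rule sum.swap)
  finally have "cnj S = S" .
  moreover have "N > 0"
    unfolding N_def using y0 by (auto intro: sum_pos2)
  ultimately have "cnj k = k"
    using S by simp
  then obtain r where r: "k = complex_of_real r"
    by (metis Reals_cnj_iff Reals_cases)
  \<comment> \<open>The characteristic polynomial of \<open>B\<close> is that of \<open>A\<close>
    with coefficients embedded in the complex numbers, so its real root \<open>r\<close> is a root
    of the real polynomial.\<close>
  have "poly (map_poly complex_of_real (char_poly A)) (complex_of_real r) = 0"
    using k[unfolded eigenvalue_root_char_poly[OF B]]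
    by (simp only: of_real_hom.char_poly_hom[OF A, symmetric] B_def r)
  then have "poly (char_poly A) r = 0"
    by simp
  then show ?thesis
    using eigenvalue_root_char_poly[OF A] by blast
qed

text \<open>Collatz-Wielandt bound: compare the eigenvector \<open>y\<close> with \<open>u\<close>
  at an index where \<open>\<bar>y i\<bar> / u i\<close> is largest; there the row inequality for
  \<open>u\<close> controls the eigenvalue equation.\<close>

lemma eigenvalue_le_of_subinvariant:
  fixes A :: "real mat"
  assumes A: "A \<in> carrier_mat n n"
    and nonneg: "\<And>i j. i < n \<Longrightarrow> j < n \<Longrightarrow> 0 \<le> A $$ (i, j)"
    and u_pos: "\<And>i. i < n \<Longrightarrow> 0 < u i"
    and sub: "\<And>i. i < n \<Longrightarrow> (\<Sum>j<n. A $$ (i, j) * u j) \<le> b * u i"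
    and "eigenvalue A k"
  shows "k \<le> b"
proof -
  obtain y where y0: "\<exists>i<n. y i \<noteq> 0"
    and y: "\<And>i. i < n \<Longrightarrow> (\<Sum>j<n. A $$ (i, j) * y j) = k * y i"
    using \<open>eigenvalue A k\<close> unfolding eigenvalue_iff_sum[OF A] by blast
  define M where "M = Max ((\<lambda>i. \<bar>y i\<bar> / u i) ` {..<n})"
  have "n > 0"
    using y0 by auto
  then have "M \<in> (\<lambda>i. \<bar>y i\<bar> / u i) ` {..<n}"
    unfolding M_def by (intro Max_in) auto
  then obtain i where i: "i < n" "M = \<bar>y i\<bar> / u i"
    by blast
  have le: "\<bar>y j\<bar> \<le> M * u j" if "j < n" for j
  proof -
    have "\<bar>y j\<bar> / u j \<le> M"
      unfolding M_def using that by (intro Max_ge) auto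
    then show ?thesis
      using u_pos[OF that] by (simp add: pos_divide_le_eq)
  qed
  have "M > 0"
  proof -
    obtain j where j: "j < n" "y j \<noteq> 0"
      using y0 by blast
    then have "0 < M * u j"
      using le[of j] by linarith
    then show ?thesis
      using u_pos[OF j(1)] by (simp add: zero_less_mult_iff)
  qed
  have "\<bar>k\<bar> * \<bar>y i\<bar> = \<bar>\<Sum>j<n. A $$ (i, j) * y j\<bar>"
    using y[OF i(1)] by (simp add: abs_mult)
  also have "\<dots> \<le> (\<Sum>j<n. A $$ (i, j) * (M * u j))"
    by (rule order_trans[OF sum_abs])
      (auto intro!: sum_mono mult_left_mono le simp: abs_mult nonneg i(1))
  also have "\<dots> = M * (\<Sum>j<n. A $$ (i, j) * u j)"
    by (simp add: sum_distrib_left mult_ac)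
  also have "\<dots> \<le> M * (b * u i)"
    using sub[OF i(1)] \<open>M > 0\<close> by simp
  also have "\<dots> = b * \<bar>y i\<bar>"
    using i(2) u_pos[OF i(1)] by (simp add: field_simps)
  finally have "\<bar>k\<bar> * \<bar>y i\<bar> \<le> b * \<bar>y i\<bar>" .
  moreover have "\<bar>y i\<bar> > 0"
    using \<open>M > 0\<close> i by auto
  ultimately show ?thesis
    by (meson abs_ge_self mult_right_le_imp_le order_trans)
qed

lemma graph_spectral_radius_le:
  fixes W :: "'a::linorder set"
  assumes "finite W" and "W \<noteq> {}"
    and u_pos: "\<And>x. x \<in> W \<Longrightarrow> 0 < u x"
    and sub: "\<And>x. x \<in> W \<Longrightarrow> (\<Sum>y\<in>{y\<in>W. {x, y} \<in> F}. u y) \<le> b * u x"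
  shows "graph_spectral_radius (W, F) \<le> b"
proof -
  define n where "n = card W"
  define l where "l = (!) (sorted_list_of_set W)"
  define A where "A = adjacency_matrix (W, F)"
  have A: "A \<in> carrier_mat n n"
    by (simp add: A_def adjacency_matrix_def n_def)
  have Aij: "A $$ (i, j) = (if {l i, l j} \<in> F then 1 else 0)" if "i < n" "j < n" for i j
    using that by (simp add: A_def adjacency_matrix_def n_def l_def)
  have l: "bij_betw l {..<n} W"
    unfolding l_def n_def using \<open>finite W\<close> by (intro bij_betw_nth) auto
  have lW: "l i \<in> W" if "i < n" for i
    using l that by (auto simp: bij_betw_def)
  have "n > 0"
    using assms(1,2) by (simp add: n_def card_gt_0_iff)
  have "k \<le> b" if "eigenvalue A k" for k
  proof (rule eigenvalue_le_of_subinvariant[OF A _ _ _ that, where u = "\<lambda>i. u (l i)"])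
    fix i assume i: "i < n"
    have "(\<Sum>j<n. A $$ (i, j) * u (l j)) = (\<Sum>j<n. if {l i, l j} \<in> F then u (l j) else 0)"
      by (intro sum.cong refl) (simp add: Aij i)
    also have "\<dots> = (\<Sum>y\<in>W. if {l i, y} \<in> F then u y else 0)"
      by (rule sum.reindex_bij_betw[OF l])
    also have "\<dots> = (\<Sum>y\<in>{y\<in>W. {l i, y} \<in> F}. u y)"
      using \<open>finite W\<close> by (simp add: sum.inter_filter)
    finally show "(\<Sum>j<n. A $$ (i, j) * u (l j)) \<le> b * u (l i)"
      using sub[OF lW[OF i]] by simp
  qed (auto simp: Aij u_pos lW)
  moreover have "\<exists>k. eigenvalue A k"
    using A \<open>n > 0\<close> by (rule symmetric_real_mat_eigenvalue_exists) (simp add: Aij insert_commute)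
  moreover have "finite {k. eigenvalue A k}"
    using card_finite_spectrum(1)[OF A] by (simp add: spectrum_def)
  ultimately show ?thesis
    unfolding graph_spectral_radius_def A_def[symmetric] by (subst Max_le_iff) auto
qed

section \<open>Duality between fractional matchings and fractional covers\<close>

text \<open>First-order optimality without derivatives: for small \<open>h\<close> a negative linear
  term would outweigh the quadratic one.\<close>

lemma linear_coeff_nonneg:
  fixes D C :: real
  assumes "C \<ge> 0" and quad: "\<And>h. 0 < h \<Longrightarrow> h \<le> 1 \<Longrightarrow> 0 \<le> 2 * h * D + h\<^sup>2 * C"
  shows "D \<ge> 0"
proof (rule ccontr)
  assume "\<not> D \<ge> 0"
  then have D: "D < 0" by simp
  \<comment> \<open>Dividing by \<open>C + 1\<close> avoids a zero denominator and makes
    \<open>h * C\<close> smaller than \<open>- 2 * D\<close>.\<close>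
  define h where "h = min 1 (- D / (C + 1))"
  have h: "0 < h" "h \<le> 1"
    using D \<open>C \<ge> 0\<close> by (auto simp: h_def divide_neg_pos)
  have "h \<le> - D / (C + 1)"
    by (simp add: h_def)
  then have "h * (C + 1) \<le> - D"
    using \<open>C \<ge> 0\<close> by (subst (asm) pos_le_divide_eq) simp_all
  then have "h * C < - 2 * D"
    using D h by (simp add: algebra_simps)
  then have "h * (2 * D + h * C) < 0"
    using h by (simp add: mult_pos_neg)
  moreover have "h * (2 * D + h * C) = 2 * h * D + h\<^sup>2 * C"
    by (simp add: algebra_simps power2_eq_square)
  ultimately show False
    using quad[OF h] by simp
qed

text \<open>The squared positive part has derivative \<open>2 * max 0 x\<close>; this is its
  second-order expansion as an upper bound. It holds because \<open>max 0 (x + h)\<close> is at most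
  the absolute value of \<open>max 0 x + h\<close>, whose square is the right-hand side.\<close>

lemma positive_part_square_le:
  fixes x h :: real
  shows "(max 0 (x + h))\<^sup>2 \<le> (max 0 x)\<^sup>2 + 2 * (max 0 x * h) + h\<^sup>2"
proof -
  have "max 0 (x + h) \<le> \<bar>max 0 x + h\<bar>"
    by linarith
  then have "(max 0 (x + h))\<^sup>2 \<le> (max 0 x + h)\<^sup>2"
    by (metis abs_ge_zero abs_le_square_iff abs_of_nonneg max.cobounded1)
  then show ?thesis
    by (simp add: power2_eq_square algebra_simps)
qed

text \<open>Pinning the coordinates outside \<open>E\<close> to 0 makes the domain a product of
  compact sets, so Tychonoff applies; the fixed total mass is a closed condition.\<close>

lemma compact_scaled_simplex:
  fixes t :: real
  shows "compact {f :: 'a \<Rightarrow> real. (\<forall>e. f e \<in> (if e \<in> E then {0..t} else {0})) \<and> sum f E = t}"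
proof -
  define K where "K = (\<Pi>\<^sub>E e\<in>UNIV. if e \<in> E then {0..t} else {0})"
  have "compactin (product_topology (\<lambda>_. euclidean) UNIV) K"
    unfolding K_def compactin_PiE by auto
  then have "compact K"
    by (simp add: euclidean_product_topology)
  moreover have "closed {f :: 'a \<Rightarrow> real. sum f E = t}"
    by (intro closed_Collect_eq continuous_intros) simp_all
  ultimately have "compact (K \<inter> {f. sum f E = t})"
    by (rule compact_Int_closed)
  moreover have "K \<inter> {f. sum f E = t} =
      {f. (\<forall>e. f e \<in> (if e \<in> E then {0..t} else {0})) \<and> sum f E = t}"
    unfolding K_def PiE_def Pi_def extensional_UNIV by blast
  ultimately show ?thesis
    by simp
qed

text \<open>Among the weightings \<open>f\<close> of total
  mass \<open>t\<close>, minimise the sum of the squared excesses of the vertex loads over 1. If the minimum is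
  not 0, the excesses themselves, rescaled, form the fractional cover: this is the
  first-order condition for moving mass towards a single edge.\<close>

lemma fractional_matching_or_cover:
  fixes V :: "'a set" and t :: real
  assumes "finite V" and E: "E \<subseteq> Pow V" and "{} \<notin> E" and "t > 0"
  shows "(\<exists>f. fractional_matching V E f \<and> matching_size E f = t) \<or>
    (\<exists>w. (\<forall>v. 0 \<le> w v) \<and> sum w V < t \<and> (\<forall>e\<in>E. 1 \<le> sum w e))"
proof (cases "E = {}")
  \<comment> \<open>Without edges no weighting has mass \<open>t > 0\<close>, but the zero weighting
    is vacuously a cover.\<close>
  case True
  then show ?thesis
    using \<open>t > 0\<close> by (intro disjI2 exI[of _ "\<lambda>_. 0"]) simp
next
  case False
  have "finite E"
    using E \<open>finite V\<close> finite_subset by blast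
  define K where "K = {f :: 'a set \<Rightarrow> real. (\<forall>e. f e \<in> (if e \<in> E then {0..t} else {0})) \<and> sum f E = t}"
  define load where "load f v = (\<Sum>e\<in>{e\<in>E. v \<in> e}. f e)" for f :: "'a set \<Rightarrow> real" and v
  define \<Phi> where "\<Phi> f = (\<Sum>v\<in>V. (max 0 (load f v - 1))\<^sup>2)" for f
  obtain e0 where "e0 \<in> E"
    using False by blast
  then have "(\<lambda>e. if e = e0 then t else 0) \<in> K"
    using \<open>finite E\<close> \<open>t > 0\<close> by (auto simp: K_def)
  then have "K \<noteq> {}"
    by blast
  moreover have "continuous_on K \<Phi>"
    unfolding \<Phi>_def load_def
    by (intro continuous_intros continuous_on_subset[OF continuous_on_product_coordinates]) simp_all
  ultimately obtain f where "f \<in> K" and min: "\<And>g. g \<in> K \<Longrightarrow> \<Phi> f \<le> \<Phi> g"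
    using continuous_attains_inf[OF compact_scaled_simplex[of E t, folded K_def]] by blast
  have f: "\<And>e. e \<in> E \<Longrightarrow> 0 \<le> f e \<and> f e \<le> t" "sum f E = t" "\<And>e. e \<notin> E \<Longrightarrow> f e = 0"
    using \<open>f \<in> K\<close> unfolding K_def by (auto split: if_splits)
  define a where "a v = max 0 (load f v - 1)" for v
  show ?thesis
  proof (cases "\<forall>v\<in>V. a v = 0")
    case True
    have load_le: "load f v \<le> 1" if "v \<in> V" for v
      using True that by (fastforce simp: a_def max_def split: if_splits)
    \<comment> \<open>Edge weights are a priori only at most \<open>t\<close>. Each edge has a
      vertex, whose load bounds the weight of the edge.\<close>
    have "f e \<le> 1" if "e \<in> E" for e
    proof -
      obtain v where "v \<in> e"
        using \<open>e \<in> E\<close> \<open>{} \<notin> E\<close> by (metis ex_in_conv)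
      then have "f e \<le> load f v"
        unfolding load_def using \<open>finite E\<close> f(1) that by (intro member_le_sum) auto
      also have "\<dots> \<le> 1"
        using E \<open>v \<in> e\<close> that by (intro load_le) auto
      finally show ?thesis .
    qed
    then have "fractional_matching V E f"
      using f(1) load_le by (simp add: fractional_matching_def load_def)
    then show ?thesis
      using f(2) by (auto simp: matching_size_def)
  next
    case False
    have a_nonneg: "0 \<le> a v" for v
      by (simp add: a_def)
    \<comment> \<open>If \<open>a v\<close> is nonzero, \<open>load f v\<close> equals
      \<open>a v + 1\<close>.\<close>
    have a_load: "a v * load f v = a v * a v + a v" for v
      by (simp add: a_def max_def algebra_simps)
    define D where "D = (\<Sum>v\<in>V. a v * load f v)"
    obtain v where "v \<in> V" "a v \<noteq> 0"
      using False by blast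
    then have "0 < (\<Sum>v\<in>V. a v * a v)"
      using \<open>finite V\<close> a_nonneg by (intro sum_pos2[of V v]) (auto simp: less_le)
    \<comment> \<open>Strict because at least one vertex is overloaded.\<close>
    then have aD: "sum a V < D"
      by (simp add: D_def a_load sum.distrib)
    have "0 \<le> sum a V"
      by (simp add: a_nonneg sum_nonneg)
    then have "D > 0"
      using aD by simp
    have key: "D \<le> t * sum a e" if "e \<in> E" for e
    proof -
      \<comment> \<open>\<open>d\<close> is the direction in which the loads move when
        \<open>f\<close> is pulled towards the weighting with all its mass \<open>t\<close> on
        \<open>e\<close>.\<close>
      define d where "d v = (if v \<in> e then t else 0) - load f v" for v
      have "0 \<le> 2 * h * (\<Sum>v\<in>V. a v * d v) + h\<^sup>2 * (\<Sum>v\<in>V. (d v)\<^sup>2)"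
        if h: "0 < h" "h \<le> 1" for h
      proof -
        define g where "g x = (1 - h) * f x + h * (if x = e then t else 0)" for x
        have sum_g: "sum g S = (1 - h) * sum f S + h * (if e \<in> S then t else 0)" if "S \<subseteq> E" for S
          using finite_subset[OF that \<open>finite E\<close>]
          by (simp add: g_def sum.distrib sum_distrib_left[symmetric])
        have load_g: "load g v = load f v + h * d v" for v
          unfolding load_def d_def using \<open>e \<in> E\<close> by (subst sum_g) (auto simp: algebra_simps)
        have "sum g E = t"
          using \<open>e \<in> E\<close> f(2) by (subst sum_g) (auto simp: algebra_simps)
        moreover have "g x \<in> (if x \<in> E then {0..t} else {0})" for x
        proof (cases "x \<in> E")
          case True
          have "(1 - h) * f x + h * (if x = e then t else 0) \<le> (1 - h) * t + h * t"
            using f(1)[OF True] h \<open>t > 0\<close> by (intro add_mono mult_left_mono) auto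
          moreover have "0 \<le> g x"
            using f(1)[OF True] h \<open>t > 0\<close> by (simp add: g_def)
          ultimately show ?thesis
            using True by (simp add: g_def algebra_simps)
        qed (use f(3) \<open>e \<in> E\<close> in \<open>auto simp: g_def\<close>)
        ultimately have "g \<in> K"
          by (simp add: K_def)
        then have "\<Phi> f \<le> \<Phi> g"
          by (rule min)
        also have "\<Phi> g \<le> (\<Sum>v\<in>V. (a v)\<^sup>2 + 2 * (a v * (h * d v)) + (h * d v)\<^sup>2)"
          unfolding \<Phi>_def load_g
          using positive_part_square_le[of "load f v - 1" "h * d v" for v]
          by (intro sum_mono) (simp add: a_def algebra_simps)
        also have "\<dots> = \<Phi> f + (2 * h * (\<Sum>v\<in>V. a v * d v) + h\<^sup>2 * (\<Sum>v\<in>V. (d v)\<^sup>2))"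
          by (simp add: \<Phi>_def a_def[symmetric] sum.distrib sum_distrib_left power_mult_distrib mult_ac)
        finally show ?thesis
          by simp
      qed
      then have "0 \<le> (\<Sum>v\<in>V. a v * d v)"
        by (rule linear_coeff_nonneg[rotated]) (simp_all add: sum_nonneg)
      also have "\<dots> = (\<Sum>v\<in>V. if v \<in> e then t * a v else 0) - D"
        unfolding D_def sum_subtractf[symmetric] by (intro sum.cong refl) (simp add: d_def algebra_simps)
      also have "(\<Sum>v\<in>V. if v \<in> e then t * a v else 0) = (\<Sum>v\<in>V \<inter> e. t * a v)"
        using \<open>finite V\<close> by (simp add: sum.inter_restrict)
      also have "V \<inter> e = e"
        using E \<open>e \<in> E\<close> by blast
      finally show ?thesis
        by (simp add: sum_distrib_left)
    qed
    \<comment> \<open>The scaling turns \<open>key\<close> into the cover condition and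
      \<open>aD\<close> into total weight below \<open>t\<close>.\<close>
    define w where "w v = t * a v / D" for v
    have sum_w: "sum w S = t * sum a S / D" for S
      by (simp add: w_def sum_distrib_left sum_divide_distrib)
    have "sum w V < t"
      using aD \<open>D > 0\<close> \<open>t > 0\<close> by (simp add: sum_w pos_divide_less_eq)
    moreover have "1 \<le> sum w e" if "e \<in> E" for e
      using key[OF that] \<open>D > 0\<close> by (simp add: sum_w)
    moreover have "0 \<le> w v" for v
      using a_nonneg \<open>D > 0\<close> \<open>t > 0\<close> by (simp add: w_def)
    ultimately show ?thesis
      by blast
  qed
qed

section \<open>Spectral radius of graphs with a light fractional cover\<close>

text \<open>If deleting the \<open>a\<close> heaviest vertices fails, then the weights number \<open>a\<close> and
  \<open>2 * s + 1 - a\<close> in decreasing order (counted from 0) sum to at least 1. If this happened for all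
  \<open>a \<le> s\<close>, the total weight would be at least \<open>s + 1\<close>.\<close>

lemma few_neighbours_outside_small_set:
  fixes w :: "'a \<Rightarrow> real" and s :: nat
  assumes "finite W" and w_nonneg: "\<And>x. x \<in> W \<Longrightarrow> 0 \<le> w x" and w_sum: "sum w W < real s + 1"
    and cover: "\<And>x y. x \<in> W \<Longrightarrow> y \<in> W \<Longrightarrow> R x y \<Longrightarrow> 1 \<le> w x + w y"
    and irrefl: "\<And>x. \<not> R x x"
  obtains F where "F \<subseteq> W" "card F \<le> s"
    and "\<And>x. x \<in> W - F \<Longrightarrow> card {y \<in> W - F. R x y} \<le> 2 * (s - card F)"
proof (rule ccontr)
  assume "\<not> thesis"
  with that have fail: "\<exists>x\<in>W - F. 2 * (s - card F) < card {y \<in> W - F. R x y}"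
    if "F \<subseteq> W" "card F \<le> s" for F
    using that by (meson not_le)
  obtain zs where zs: "set zs = W" "distinct zs"
    using \<open>finite W\<close> finite_distinct_list by blast
  define xs where "xs = sort_key (\<lambda>x. - w x) zs"
  have xs: "set xs = W" "distinct xs"
    using zs by (simp_all add: xs_def)
  have "sorted (map (\<lambda>x. - w x) xs)"
    by (simp add: xs_def)
  then have anti: "w (xs ! j) \<le> w (xs ! i)" if "i \<le> j" "j < length xs" for i j
    using that by (auto simp: sorted_iff_nth_mono)
  have pair: "2 * s + 1 - a < length xs \<and> 1 \<le> w (xs ! a) + w (xs ! (2 * s + 1 - a))" if "a \<le> s" for a
  proof -
    define F where "F = set (take a xs)"
    have "F \<subseteq> W"
      unfolding F_def using xs(1) set_take_subset by fast
    have "card F \<le> a"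
      unfolding F_def by (metis card_length length_take min.bounded_iff)
    obtain x where x: "x \<in> W - F" "2 * (s - card F) < card {y \<in> W - F. R x y}"
      using fail[OF \<open>F \<subseteq> W\<close>] \<open>card F \<le> a\<close> \<open>a \<le> s\<close> by auto
    define N where "N = {y \<in> W - F. R x y}"
    have index: "\<exists>i\<ge>a. i < length xs \<and> z = xs ! i" if "z \<in> W - F" for z
    proof -
      have "z \<in> set xs"
        using that xs(1) by blast
      then obtain i where i: "i < length xs" "z = xs ! i"
        by (metis in_set_conv_nth)
      have "xs ! i \<in> F" if "i < a"
      proof -
        have "take a xs ! i \<in> set (take a xs)"
          using that i(1) by (intro nth_mem) simp
        then show ?thesis
          by (simp only: F_def nth_take[OF that])
      qed
      then have "\<not> i < a"
        using \<open>z \<in> W - F\<close> i(2) by blast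
      with i show ?thesis
        by (intro exI[of _ i]) simp
    qed
    then have w_le: "w z \<le> w (xs ! a)" if "z \<in> W - F" for z
      using anti that by blast
    have "finite N" "x \<notin> N" "N \<subseteq> W - F"
      using \<open>finite W\<close> irrefl by (auto simp: N_def)
    have "card N > 2 * (s - a)"
      using x(2) \<open>card F \<le> a\<close> by (simp add: N_def)
    \<comment> \<open>\<open>x\<close> and its neighbours outside \<open>F\<close> are at least
      \<open>2 * (s - a) + 2\<close> vertices, one more than there are positions from
      \<open>a\<close> to \<open>2 * s - a\<close>. So one of them, \<open>z\<close>, sits at
      position \<open>2 * s + 1 - a\<close> or later.\<close>
    then have card_N: "2 * s + 1 - a - a < card (insert x N)"
      using \<open>finite N\<close> \<open>x \<notin> N\<close> \<open>a \<le> s\<close> by simp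
    have "\<not> insert x N \<subseteq> (!) xs ` {a..<2 * s + 1 - a}"
    proof
      assume "insert x N \<subseteq> (!) xs ` {a..<2 * s + 1 - a}"
      then have "card (insert x N) \<le> card {a..<2 * s + 1 - a}"
        by (meson finite_atLeastLessThan surj_card_le)
      then show False
        using card_N by simp
    qed
    then obtain z where z: "z \<in> insert x N" "z \<notin> (!) xs ` {a..<2 * s + 1 - a}"
      by blast
    then have "z \<in> W - F"
      using x(1) \<open>N \<subseteq> W - F\<close> by blast
    then obtain i where i: "a \<le> i" "i < length xs" "z = xs ! i"
      using index by blast
    then have ge: "2 * s + 1 - a \<le> i"
      using z(2) by (metis atLeastLessThan_iff image_eqI not_le)
    then have wz: "w z \<le> w (xs ! (2 * s + 1 - a))"
      using anti i by blast
    \<comment> \<open>Besides the light vertex \<open>z\<close> an edge needs a second end: any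
      neighbour of \<open>x\<close> if \<open>z\<close> is \<open>x\<close>, and \<open>x\<close>
      itself otherwise. Either way it is no heavier than \<open>xs ! a\<close>.\<close>
    have "1 \<le> w (xs ! a) + w z"
    proof (cases "z = x")
      case True
      have "N \<noteq> {}"
        using \<open>card N > 2 * (s - a)\<close> by auto
      then obtain y where y: "y \<in> N"
        by blast
      then have "1 \<le> w x + w y"
        using cover x(1) by (auto simp: N_def)
      moreover have "w y \<le> w (xs ! a)"
        using y \<open>N \<subseteq> W - F\<close> by (intro w_le) blast
      ultimately show ?thesis
        using True by simp
    next
      case False
      then have "1 \<le> w x + w z"
        using z(1) cover x(1) by (auto simp: N_def)
      then show ?thesis
        using w_le[OF x(1)] by simp
    qed
    then show ?thesis
      using wz ge i(2) by simp
  qed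
  define g where "g i = w (xs ! i)" for i
  have len: "2 * s + 1 < length xs"
    using pair[of 0] by simp
  \<comment> \<open>The pairs of positions \<open>a\<close> and \<open>2 * s + 1 - a\<close> with
    \<open>a \<le> s\<close> are disjoint and fill the positions below \<open>2 * s + 2\<close>, so
    these weights alone reach \<open>s + 1\<close>.\<close>
  have "real s + 1 = (\<Sum>a<s + 1. 1)"
    by simp
  also have "\<dots> \<le> (\<Sum>a<s + 1. g a + g (2 * s + 1 - a))"
    using pair by (intro sum_mono) (simp add: g_def)
  also have "\<dots> = (\<Sum>a<s + 1. g a) + (\<Sum>a<s + 1. g (2 * s + 1 - a))"
    by (rule sum.distrib)
  also have "(\<Sum>a<s + 1. g (2 * s + 1 - a)) = sum g {s + 1..<2 * s + 2}"
    by (rule sum.reindex_bij_witness[of _ "\<lambda>j. 2 * s + 1 - j" "\<lambda>a. 2 * s + 1 - a"]) auto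
  also have "(\<Sum>a<s + 1. g a) + sum g {s + 1..<2 * s + 2} = sum g {..<2 * s + 2}"
    unfolding lessThan_atLeast0 by (rule sum.atLeastLessThan_concat) auto
  also have "\<dots> \<le> sum g {..<length xs}"
    using len xs(1) w_nonneg by (intro sum_mono2) (auto simp: g_def)
  also have "\<dots> = sum w W"
    unfolding g_def using xs by (intro sum.reindex_bij_betw bij_betw_nth) auto
  finally show False
    using w_sum by simp
qed

text \<open>The positive test vector is \<open>b\<close> on the small set and \<open>s\<close> elsewhere. The equation for \<open>b\<close>
  is the characteristic equation of the join of a complete graph on \<open>s\<close> vertices with an
  independent set, and \<open>2 * s\<close> is the spectral radius of the complete graph on \<open>2 * s + 1\<close>
  vertices; these are the two extremal graphs.\<close>

lemma graph_spectral_radius_le_of_fractional_cover: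
  fixes W :: "'a::linorder set" and s :: nat and b :: real
  assumes "finite W" "W \<noteq> {}" and "s > 0"
    and loopless: "\<And>x. {x} \<notin> F"
    and w_nonneg: "\<And>x. x \<in> W \<Longrightarrow> 0 \<le> w x" and w_sum: "sum w W < real s + 1"
    and cover: "\<And>x y. x \<in> W \<Longrightarrow> y \<in> W \<Longrightarrow> {x, y} \<in> F \<Longrightarrow> 1 \<le> w x + w y"
    and b_ge: "2 * real s \<le> b"
    and b_root: "b\<^sup>2 = (real s - 1) * b + real s * (real (card W) - real s)"
  shows "graph_spectral_radius (W, F) \<le> b"
proof -
  obtain S where S: "S \<subseteq> W" "card S \<le> s"
    and sparse: "\<And>x. x \<in> W - S \<Longrightarrow> card {y \<in> W - S. {x, y} \<in> F} \<le> 2 * (s - card S)"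
    using few_neighbours_outside_small_set[OF \<open>finite W\<close> w_nonneg w_sum, where R = "\<lambda>x y. {x, y} \<in> F"]
      cover loopless by auto
  have "finite S"
    using S(1) \<open>finite W\<close> finite_subset by blast
  define u where "u x = (if x \<in> S then b else real s)" for x
  have "b > 0"
    using b_ge \<open>s > 0\<close> by linarith
  show ?thesis
  proof (rule graph_spectral_radius_le[where u = u])
    fix x assume "x \<in> W"
    define N where "N = {y \<in> W. {x, y} \<in> F}"
    have "finite N"
      using \<open>finite W\<close> by (simp add: N_def)
    have "sum u N = sum u (N \<inter> S) + sum u (N - S)"
      using \<open>finite N\<close> by (metis sum.Int_Diff)
    also have "sum u (N \<inter> S) = real (card (N \<inter> S)) * b"
      by (simp add: u_def)
    also have "sum u (N - S) = real (card (N - S)) * real s"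
      by (simp add: u_def)
    finally have sum_N: "sum u N = real (card (N \<inter> S)) * b + real (card (N - S)) * real s" .
    show "sum u {y \<in> W. {x, y} \<in> F} \<le> b * u x"
    proof (cases "x \<in> S")
      case True
      have "N \<inter> S \<subseteq> S - {x}"
        using loopless by (auto simp: N_def)
      then have "card (N \<inter> S) \<le> card S - 1"
        using \<open>finite S\<close> True by (metis card_Diff_singleton card_mono finite_Diff)
      moreover have "card S > 0"
        using True \<open>finite S\<close> card_gt_0_iff by blast
      ultimately have 1: "real (card (N \<inter> S)) \<le> real (card S) - 1"
        by linarith
      have "card (N - S) \<le> card (W - S)"
        using \<open>finite W\<close> by (intro card_mono) (auto simp: N_def)
      moreover have "card S \<le> card W"
        using \<open>finite W\<close> S(1) by (rule card_mono)
      ultimately have 2: "real (card (N - S)) \<le> real (card W) - real (card S)"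
        using card_Diff_subset[OF \<open>finite S\<close> S(1)] by simp
      \<comment> \<open>Worst case: \<open>x\<close> is adjacent to all other vertices of
        \<open>S\<close> and to everything outside.\<close>
      have "sum u N \<le> (real (card S) - 1) * b + (real (card W) - real (card S)) * real s"
        unfolding sum_N using 1 2 \<open>b > 0\<close> by (intro add_mono mult_right_mono) auto
      \<comment> \<open>For \<open>card S = s\<close> this is \<open>b_root\<close>; otherwise the
        deficit is nonnegative since \<open>b \<ge> s\<close>.\<close>
      also have "\<dots> = b\<^sup>2 - (real s - real (card S)) * (b - real s)"
        unfolding b_root by (simp add: algebra_simps)
      also have "\<dots> \<le> b\<^sup>2"
        using S(2) b_ge by simp
      finally show ?thesis
        using True by (simp add: u_def N_def power2_eq_square)
    next
      case False
      have 1: "real (card (N \<inter> S)) \<le> real (card S)"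
        using \<open>finite S\<close> by (simp add: card_mono)
      have "N - S = {y \<in> W - S. {x, y} \<in> F}"
        by (auto simp: N_def)
      then have "real (card (N - S)) \<le> real (2 * (s - card S))"
        using sparse[of x] \<open>x \<in> W\<close> False by simp
      then have 2: "real (card (N - S)) \<le> 2 * (real s - real (card S))"
        using S(2) by (simp add: of_nat_diff)
      have "sum u N \<le> real (card S) * b + 2 * (real s - real (card S)) * real s"
        unfolding sum_N using 1 2 \<open>b > 0\<close> by (intro add_mono mult_right_mono) auto
      \<comment> \<open>Here \<open>b_ge\<close> is used in full: it makes the deficit
        nonnegative.\<close>
      also have "\<dots> = b * real s - (real s - real (card S)) * (b - 2 * real s)"
        by (simp add: algebra_simps)
      also have "\<dots> \<le> b * real s"
        using S(2) b_ge by simp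
      finally show ?thesis
        using False by (simp add: u_def N_def)
    qed
  qed (use assms \<open>b > 0\<close> in \<open>auto simp: u_def\<close>)
qed

section \<open>From covers of the 3-graph to covers of a link graph\<close>

text \<open>Take \<open>v\<close> of smallest weight \<open>m\<close>. An edge
  \<open>{x, y, v}\<close> gives \<open>w x + w y - 2 * m \<ge> 1 - 3 * m\<close>, so shifting by
  \<open>m\<close> and dividing by \<open>1 - 3 * m\<close> covers the link. As
  \<open>card V\<close> is at least \<open>3 * s + 3\<close>, the shift removes at least
  \<open>3 * m * (s + 1)\<close> from the total, so the rescaled total stays below
  \<open>s + 1\<close>.\<close>

lemma link_graph_spectral_radius_le_of_fractional_cover:
  fixes V :: "'a::linorder set" and s :: nat and b :: real
  assumes G: "three_graph V E" and "s > 0" and card_V: "card V \<ge> 3 * s + 3"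
    and w_nonneg: "\<And>x. 0 \<le> w x" and w_sum: "sum w V < real s + 1"
    and cover: "\<And>e. e \<in> E \<Longrightarrow> 1 \<le> sum w e"
    and b_ge: "2 * real s \<le> b"
    and b_root: "b\<^sup>2 = (real s - 1) * b + real s * (real (card V) - 1 - real s)"
  shows "\<exists>v\<in>V. graph_spectral_radius (link_graph V E v) \<le> b"
proof -
  have "finite V"
    using G by (simp add: three_graph_def)
  have "V \<noteq> {}"
    using card_V by auto
  define m where "m = Min (w ` V)"
  have "m \<in> w ` V"
    unfolding m_def using \<open>finite V\<close> \<open>V \<noteq> {}\<close> by (intro Min_in) auto
  then obtain v where v: "v \<in> V" "w v = m"
    by blast
  have m_le: "m \<le> w x" if "x \<in> V" for x
    unfolding m_def using \<open>finite V\<close> that by simp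
  have "m \<ge> 0"
    using v(2) w_nonneg by metis
  \<comment> \<open>The minimum is at most the average, which is below 1/3; hence the divisor
    \<open>1 - 3 * m\<close> is positive.\<close>
  have "real (card V) * m \<le> sum w V"
    using sum_mono[of V "\<lambda>_. m" w] m_le by simp
  moreover have "(3 * real s + 3) * m \<le> real (card V) * m"
    using card_V \<open>m \<ge> 0\<close> by (intro mult_right_mono) linarith+
  ultimately have "(real s + 1) * (3 * m) < (real s + 1) * 1"
    using w_sum by (simp add: algebra_simps)
  then have m3: "3 * m < 1"
    by (subst (asm) mult_less_cancel_left_pos) simp_all
  define w' where "w' x = (w x - m) / (1 - 3 * m)" for x
  define F where "F = {e. e \<subseteq> V - {v} \<and> e \<union> {v} \<in> E}"
  have card_E: "card e = 3" if "e \<in> E" for e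
    using G that by (auto simp: three_graph_def nsets_def)
  have card_W: "card (V - {v}) = card V - 1"
    using v(1) by simp
  have "graph_spectral_radius (V - {v}, F) \<le> b"
  proof (rule graph_spectral_radius_le_of_fractional_cover[where w = w' and s = s])
    show "finite (V - {v})"
      using \<open>finite V\<close> by simp
    have "card (V - {v}) \<noteq> 0"
      using card_V card_W by simp
    then show "V - {v} \<noteq> {}"
      by (metis card.empty)
    show "{x} \<notin> F" for x
    proof
      assume "{x} \<in> F"
      then have "card ({x} \<union> {v}) = 3"
        using card_E by (simp add: F_def)
      then show False
        by (cases "x = v") auto
    qed
    show "0 \<le> w' x" if "x \<in> V - {v}" for x
      using m_le[of x] that m3 by (simp add: w'_def)
    have "sum w' (V - {v}) = (\<Sum>x\<in>V - {v}. w x - m) / (1 - 3 * m)"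
      by (simp add: w'_def sum_divide_distrib)
    \<comment> \<open>The term at \<open>v\<close> is 0 because \<open>w v = m\<close>.\<close>
    also have "(\<Sum>x\<in>V - {v}. w x - m) = (\<Sum>x\<in>V. w x - m)"
      using v \<open>finite V\<close> by (simp add: sum.remove)
    also have "\<dots> = sum w V - real (card V) * m"
      by (simp add: sum_subtractf)
    also have "(sum w V - real (card V) * m) / (1 - 3 * m) < real s + 1"
      using w_sum \<open>(3 * real s + 3) * m \<le> real (card V) * m\<close> m3
      by (simp add: pos_divide_less_eq algebra_simps)
    finally show "sum w' (V - {v}) < real s + 1" .
    show "1 \<le> w' x + w' y" if "x \<in> V - {v}" "y \<in> V - {v}" "{x, y} \<in> F" for x y
    proof -
      have e: "{x, y, v} \<in> E"
        using that(3) by (simp add: F_def insert_commute)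
      \<comment> \<open>An edge has three elements, so a repeated vertex is impossible and the sum
        over the edge splits into three weights.\<close>
      have "x \<noteq> y"
        using card_E[OF e] by (auto simp: card_insert_if split: if_splits)
      then have "1 \<le> w x + w y + m"
        using cover[OF e] that v(2) by (simp add: algebra_simps)
      then show ?thesis
        using m3 by (simp add: w'_def add_divide_distrib[symmetric] pos_le_divide_eq)
    qed
    show "b\<^sup>2 = (real s - 1) * b + real s * (real (card (V - {v})) - real s)"
      using b_root card_V by (simp add: card_W of_nat_diff)
  qed fact+
  then show ?thesis
    using v(1) by (auto simp: link_graph_def F_def)
qed

section \<open>The closed form of the bound\<close>

text \<open>\<open>b\<close> is the larger root of the quadratic equation that the test vector
  requires. Its discriminant equals \<open>(3 * s + 1)\<^sup>2 + 4 * s * (n - (3 * s + 3))\<close>,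
  which gives \<open>2 * s \<le> b\<close>, with equality at \<open>n = 3 * s + 3\<close>.\<close>

lemma quadratic_root_properties:
  fixes s n :: real
  assumes "s \<ge> 0" and "n \<ge> 3 * s + 3"
  defines "b \<equiv> (1 / 2) * (s - 1 + sqrt ((s - 1)\<^sup>2 + 4 * s * (n - s - 1)))"
  shows "2 * s \<le> b" and "b\<^sup>2 = (s - 1) * b + s * (n - 1 - s)"
    and "n = 3 * s + 3 \<Longrightarrow> b = 2 * s"
proof -
  define r where "r = sqrt ((s - 1)\<^sup>2 + 4 * s * (n - s - 1))"
  have b: "b = (s - 1 + r) / 2"
    by (simp add: b_def r_def)
  have disc: "(s - 1)\<^sup>2 + 4 * s * (n - s - 1) = (3 * s + 1)\<^sup>2 + 4 * s * (n - (3 * s + 3))"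
    by (simp add: power2_eq_square algebra_simps)
  have "0 \<le> 4 * s * (n - (3 * s + 3))"
    using assms(1,2) by simp
  then have "(3 * s + 1)\<^sup>2 \<le> (s - 1)\<^sup>2 + 4 * s * (n - s - 1)"
    unfolding disc by simp
  then have "3 * s + 1 \<le> r"
    unfolding r_def by (rule real_le_rsqrt)
  have "0 \<le> (s - 1)\<^sup>2 + 4 * s * (n - s - 1)"
    using assms(1,2) by simp
  then have r_sq: "r\<^sup>2 = (s - 1)\<^sup>2 + 4 * s * (n - s - 1)"
    unfolding r_def by (rule real_sqrt_pow2)
  show "2 * s \<le> b"
    using \<open>3 * s + 1 \<le> r\<close> by (simp add: b)
  show "b\<^sup>2 = (s - 1) * b + s * (n - 1 - s)"
    using r_sq by (simp add: b power2_eq_square field_simps)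
  show "b = 2 * s" if "n = 3 * s + 3"
    using that assms(1) disc by (simp add: b r_def)
qed

section \<open>Perfect fractional matchings and conclusion\<close>

text \<open>Double counting: every edge contributes its weight at each of its three
  vertices.\<close>

lemma sum_vertex_loads:
  fixes f :: "'a set \<Rightarrow> real"
  assumes "three_graph V E"
  shows "(\<Sum>v\<in>V. \<Sum>e\<in>{e\<in>E. v \<in> e}. f e) = 3 * matching_size E f"
proof -
  have "finite V" and E: "\<And>e. e \<in> E \<Longrightarrow> e \<subseteq> V \<and> card e = 3"
    using assms by (auto simp: three_graph_def nsets_def)
  then have "finite E"
    by (meson Pow_iff finite_Pow_iff finite_subset subsetI)
  have "(\<Sum>v\<in>V. \<Sum>e\<in>{e\<in>E. v \<in> e}. f e) = (\<Sum>e\<in>E. \<Sum>v\<in>{v\<in>V. v \<in> e}. f e)"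
    by (rule sum.swap_restrict[OF \<open>finite V\<close> \<open>finite E\<close>])
  also have "\<dots> = (\<Sum>e\<in>E. 3 * f e)"
  proof (rule sum.cong[OF refl])
    fix e assume "e \<in> E"
    then have "{v \<in> V. v \<in> e} = e"
      using E by blast
    then show "(\<Sum>v\<in>{v\<in>V. v \<in> e}. f e) = 3 * f e"
      using E[OF \<open>e \<in> E\<close>] by simp
  qed
  finally show ?thesis
    by (simp add: matching_size_def sum_distrib_left)
qed

text \<open>At this size the slacks \<open>d v\<close> at the vertices add up to 0; being
  nonnegative, they all vanish.\<close>

lemma perfect_fractional_matchingI:
  assumes "three_graph V E" and f: "fractional_matching V E f"
    and size: "3 * matching_size E f = real (card V)"
  shows "perfect_fractional_matching V E f"
proof -
  have "finite V"
    using assms(1) by (simp add: three_graph_def)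
  define d where "d v = 1 - (\<Sum>e\<in>{e\<in>E. v \<in> e}. f e)" for v
  have "d v \<ge> 0" if "v \<in> V" for v
    using f that by (simp add: fractional_matching_def d_def)
  moreover have "sum d V = 0"
    using sum_vertex_loads[OF assms(1), of f] size by (simp add: d_def sum_subtractf)
  ultimately have "\<forall>v\<in>V. d v = 0"
    using \<open>finite V\<close> by (simp add: sum_nonneg_eq_0_iff)
  then show ?thesis
    using f by (simp add: perfect_fractional_matching_def d_def)
qed

theorem theorem1p4:
  fixes n s :: nat and E :: "nat set set"
  assumes "n > 0" and "s > 0" and "n \<ge> 3 * s + 3"
    and "three_graph {1..n} E"
  shows "((\<forall>v\<in>{1..n}. graph_spectral_radius (link_graph {1..n} E v) >
             (1 / 2) * (real s - 1 + sqrt ((real s - 1)^2 + 4 * real s * (real n - real s - 1))))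
           \<longrightarrow> (\<exists>f. fractional_matching {1..n} E f \<and> matching_size E f = real s + 1)) \<and>
         (n = 3 * s + 3 \<and>
             (\<forall>v\<in>{1..n}. graph_spectral_radius (link_graph {1..n} E v) > 2 * real n / 3 - 2)
           \<longrightarrow> (\<exists>f. perfect_fractional_matching {1..n} E f))"
proof -
  define b where
    "b = (1 / 2) * (real s - 1 + sqrt ((real s - 1)^2 + 4 * real s * (real n - real s - 1)))"
  have "3 * real s + 3 \<le> real n"
    using \<open>n \<ge> 3 * s + 3\<close> by linarith
  note b = quadratic_root_properties[OF of_nat_0_le_iff this, folded b_def]
  have main: "\<exists>f. fractional_matching {1..n} E f \<and> matching_size E f = real s + 1"
    if rho: "\<forall>v\<in>{1..n}. graph_spectral_radius (link_graph {1..n} E v) > b"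
  proof (rule ccontr)
    assume no_matching: "\<not> ?thesis"
    have E: "E \<subseteq> Pow {1..n}" "{} \<notin> E"
      using \<open>three_graph {1..n} E\<close> by (auto simp: three_graph_def nsets_def)
    have "0 < real s + 1"
      by simp
    then obtain w where
      "\<forall>v. 0 \<le> w v" "sum w {1..n} < real s + 1" "\<forall>e\<in>E. 1 \<le> sum w e"
      using fractional_matching_or_cover[OF finite_atLeastAtMost E] no_matching by blast
    then have "\<exists>v\<in>{1..n}. graph_spectral_radius (link_graph {1..n} E v) \<le> b"
      using assms b(1,2) by (intro link_graph_spectral_radius_le_of_fractional_cover[where s = s]) auto
    then show False
      using rho by force
  qed
  have "\<exists>f. perfect_fractional_matching {1..n} E f"
    if n: "n = 3 * s + 3"
      and rho: "\<forall>v\<in>{1..n}. graph_spectral_radius (link_graph {1..n} E v) > 2 * real n / 3 - 2"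
  proof -
    \<comment> \<open>At \<open>n = 3 * s + 3\<close> both thresholds equal \<open>2 * s\<close>, so
      \<open>main\<close> applies; its size \<open>s + 1\<close> is a third of the number of
      vertices.\<close>
    have "b = 2 * real n / 3 - 2"
      using b(3) n by (simp add: field_simps)
    then obtain f where f: "fractional_matching {1..n} E f" "matching_size E f = real s + 1"
      using main rho by auto
    have "3 * matching_size E f = real (card {1..n})"
      using f(2) n by simp
    then show ?thesis
      using perfect_fractional_matchingI[OF assms(4) f(1)] by blast
  qed
  then show ?thesis
    using main unfolding b_def by blast
qed

end
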